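(* Let $m\geq 4$ be even, and let $e$ be an integer with $2 \leq e \leq m/2$ and $\gcd(m,e)=2$. Let $\alpha$ be a generator of $\mathbb{F}_{2^m}^*$, let $\mathcal{C}_E$ be the binary cyclic code of length $2^m-1$ with generator polynomial $\operatorname{lcm}\big(\mathbb{M}_{\alpha}(x),\mathbb{M}_{\alpha^{1+2^e}}(x)\big)$, and let $\overline{\mathcal{C}_E}$ be its extended code, with coordinates indexed by $V=\{0,1,\dots,2^m-1\}$. Then the supports of the codewords of Hamming weight $4$ in $\overline{\mathcal{C}_E}$ form a $2$-$(2^m,4,1)$ design on $V$, i.e., a Steiner system $S(2,4,2^m)$.
   Context: $\mathbb{M}_{\beta}(x)$ denotes the minimal polynomial of $\beta\in\mathbb{F}_{2^m}$ over $\mathbb{F}_2$. A binary cyclic code of length $n$ with generator polynomial $g(x)$ is the ideal generated by $g(x)$ in $\mathbb{F}_2[x]/(x^n-1)$, identified with vectors in $\mathbb{F}_2^n$. The extended code is obtained by appending an overall parity-check coordinate (sum of all coordinates) to each codeword. The support of a codeword is the set of coordinates where it is nonzero. A $2$-$(v,k,\lambda)$ design is a pair $(V,\mathcal{B})$ with $|V|=v$ and $\mathcal{B}$ a set of $k$-subsets of $V$ such that every $2$-subset of $V$ is contained in exactly $\lambda$ members of $\mathcal{B}$; a $2$-$(v,k,1)$ design is a Steiner system $S(2,k,v)$. *)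

theory Defs
  imports
    "HOL-Library.Z2"
    "HOL-Library.Cardinality"
    "HOL-Computational_Algebra.Computational_Algebra"
    "HOL-Computational_Algebra.Field_as_Ring"
    "HOL-Number_Theory.Cong"
begin

text \<open>
  The field $\mathbb{F}_2$ is the library type \<^typ>\<open>bit\<close>. The instances below make the
  library operation \<^const>\<open>lcm\<close> (monic on nonzero arguments) available on \<^typ>\<open>bit poly\<close>.
  The operation \<open>mod\<close> on \<^typ>\<open>bit\<close> is already fixed in \<^theory>\<open>HOL-Library.Z2\<close>.
\<close>

instantiation bit ::
  "{unique_euclidean_ring, normalization_euclidean_semiring, normalization_semidom_multiplicative}"
begin

definition [simp]: "normalize_bit = (normalize_field :: bit \<Rightarrow> _)"
definition [simp]: "unit_factor_bit = (unit_factor_field :: bit \<Rightarrow> _)"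
definition [simp]: "euclidean_size_bit = (euclidean_size_field :: bit \<Rightarrow> _)"
definition [simp]: "division_segment (x :: bit) = 1"

instance
proof
  fix a b c :: bit
  show "euclidean_size (a mod b) < euclidean_size b" if "b \<noteq> 0"
    using that by simp
  show "(q * b + r) div b = q"
    if "b \<noteq> 0" "division_segment r = division_segment b" "euclidean_size r < euclidean_size b"
    for q r :: bit
    using that by (cases q; cases r) (auto split: if_splits)
qed (auto simp: dvd_field_iff split: if_splits)

end

instantiation bit :: euclidean_ring_gcd
begin

definition gcd_bit :: "bit \<Rightarrow> bit \<Rightarrow> bit" where
  "gcd_bit = Euclidean_Algorithm.gcd"
definition lcm_bit :: "bit \<Rightarrow> bit \<Rightarrow> bit" where
  "lcm_bit = Euclidean_Algorithm.lcm"
definition Gcd_bit :: "bit set \<Rightarrow> bit" where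
  "Gcd_bit = Euclidean_Algorithm.Gcd"
definition Lcm_bit :: "bit set \<Rightarrow> bit" where
  "Lcm_bit = Euclidean_Algorithm.Lcm"

instance
  by standard (simp_all add: gcd_bit_def lcm_bit_def Gcd_bit_def Lcm_bit_def)

end

instance bit :: field_gcd ..

text \<open>
  \<open>map_poly of_bit\<close> views a polynomial over $\mathbb{F}_2$ as one over the extension; \<open>of_bit\<close>
  is the embedding of $\mathbb{F}_2$ only when the target field has characteristic 2.
\<close>

definition is_min_poly :: "'a::field \<Rightarrow> bit poly \<Rightarrow> bool" where
  "is_min_poly \<beta> p \<longleftrightarrow>
     lead_coeff p = 1 \<and> poly (map_poly of_bit p) \<beta> = 0 \<and>
     (\<forall>q. q \<noteq> 0 \<and> poly (map_poly of_bit q) \<beta> = 0 \<longrightarrow> degree p \<le> degree q)"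

definition min_poly :: "'a::field \<Rightarrow> bit poly" where
  "min_poly \<beta> = (THE p. is_min_poly \<beta> p)"

definition generates_units :: "'a::field \<Rightarrow> bool" where
  "generates_units \<alpha> \<longleftrightarrow> range (\<lambda>k::int. \<alpha> powi k) = UNIV - {0}"

text \<open>
  The word $(c_0,\dots,c_{n-1})$ is the list of its coordinates and is identified with the class
  of $c_0 + c_1 x + \dots + c_{n-1} x^{n-1}$ modulo $x^n - 1$.
\<close>

definition cyclic_code :: "nat \<Rightarrow> bit poly \<Rightarrow> bit list set" where
  "cyclic_code n g = {c. length c = n \<and> (\<exists>a. [Poly c = a * g] (mod (monom 1 n - 1)))}"

definition extended_code :: "bit list set \<Rightarrow> bit list set" where
  "extended_code C = (\<lambda>c. c @ [sum_list c]) ` C"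

definition support :: "bit list \<Rightarrow> nat set" where
  "support c = {i. i < length c \<and> c ! i \<noteq> 0}"

definition hamming_weight :: "bit list \<Rightarrow> nat" where
  "hamming_weight c = card (support c)"

text \<open>For \<open>l = 1\<close> this is a Steiner system $S(2,k,v)$.\<close>

definition two_design :: "nat \<Rightarrow> nat \<Rightarrow> nat \<Rightarrow> 'v set \<Rightarrow> 'v set set \<Rightarrow> bool" where
  "two_design v k l V \<B> \<longleftrightarrow>
     finite V \<and> card V = v \<and>
     (\<forall>B\<in>\<B>. B \<subseteq> V \<and> card B = k) \<and>
     (\<forall>P. P \<subseteq> V \<and> card P = 2 \<longrightarrow> card {B \<in> \<B>. P \<subseteq> B} = l)"

end

theory Submission
  imports "HOL-Number_Theory.Residues" Defs
begin

text \<open>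
  Label the coordinates of the extended code by the elements of $\mathbb{F}_{2^m}$. A word of even
  weight with support $S$ then lies in the extended code iff $\sum_{t \in S} t = 0$ and
  $\sum_{t \in S} t^{1+Q} = 0$, where $Q = 2^e$. If $|S| = 4$, the first condition means
  $S = \{x, x+u, x+v, x+u+v\}$, and the second sum becomes $u v^Q + u^Q v$. It vanishes iff $v/u$
  is fixed by the $Q$-power map, i.e. lies in the subfield
  $\mathbb{F}_{2^{\gcd(m,e)}} = \mathbb{F}_4$, and then $S = x + u\,\mathbb{F}_4$. Hence the blocks
  are the affine lines over $\mathbb{F}_4$, and two points lie on exactly one line.
\<close>

section \<open>Fixed points of the Frobenius map\<close>

lemma prime_CHAR_finite: "prime CHAR('a::{idom,finite})"
  by (intro prime_CHAR_semidom finite_imp_CHAR_pos finite)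

lemma CHAR_eq_if_CARD_eq_prime_power:
  assumes "prime p" and "CARD('a::{idom,finite}) = p ^ m"
  shows "CHAR('a) = p"
proof -
  have "CHAR('a) dvd p ^ m"
    using CHAR_dvd_CARD[where 'a = 'a] assms(2) by simp
  hence "CHAR('a) dvd p"
    using prime_dvd_power[OF prime_CHAR_finite] by blast
  thus ?thesis
    using assms(1) prime_CHAR_finite by (intro primes_dvd_imp_eq)
qed

lemma CARD_gt_one: "CARD('a::{zero_neq_one,finite}) > 1"
proof -
  have "card {0, 1 :: 'a} \<le> CARD('a)"
    by (rule card_mono) simp_all
  thus ?thesis
    by simp
qed

lemma power_CARD_minus_one_eq_one:
  fixes x :: "'a::{field,finite}"
  assumes "x \<noteq> 0"
  shows "x ^ (CARD('a) - 1) = 1"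
proof -
  have "(\<Prod>y\<in>UNIV - {0}. x * y) = \<Prod>(UNIV - {0})"
    by (rule prod.reindex_bij_witness[of _ "\<lambda>y. y / x" "\<lambda>y. x * y"]) (use assms in auto)
  hence "x ^ (CARD('a) - 1) * \<Prod>(UNIV - {0}) = \<Prod>(UNIV - {0})"
    by (simp add: prod.distrib)
  thus ?thesis
    by simp
qed

lemma power_CARD_eq_self:
  fixes x :: "'a::{field,finite}"
  shows "x ^ CARD('a) = x"
  using power_CARD_minus_one_eq_one[of x]
  by (cases "x = 0") (simp_all add: power_eq_if)

lemma frobenius_diff:
  fixes x y :: "'a::comm_ring_1"
  assumes "prime CHAR('a)"
  shows "(x - y) ^ (CHAR('a) ^ k) = x ^ (CHAR('a) ^ k) - y ^ (CHAR('a) ^ k)"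
  using freshmans_dream'[OF assms refl, of "x - y" y k] by (simp add: eq_diff_eq)

lemma frobenius_diff_self_dvd:
  fixes x :: "'a::comm_ring_1"
  assumes "prime CHAR('a)" and "d dvd m"
  shows "x ^ (CHAR('a) ^ d) - x dvd x ^ (CHAR('a) ^ m) - x"
proof -
  have "x ^ (CHAR('a) ^ d) - x dvd x ^ (CHAR('a) ^ (d * k)) - x" for k
  proof (induction k)
    case (Suc k)
    have "x ^ (CHAR('a) ^ (d * Suc k)) - x
        = (x ^ (CHAR('a) ^ (d * k)) - x) ^ (CHAR('a) ^ d) + (x ^ (CHAR('a) ^ d) - x)"
      by (simp add: frobenius_diff[OF assms(1)] power_add mult.commute flip: power_mult)
    moreover have "x ^ (CHAR('a) ^ d) - x dvd (x ^ (CHAR('a) ^ (d * k)) - x) ^ (CHAR('a) ^ d)"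
      using Suc.IH prime_gt_0_nat[OF assms(1)] by (simp add: dvd_trans[OF _ dvd_power])
    ultimately show ?case
      by (simp only: dvd_add_triv_right_iff)
  qed simp
  thus ?thesis
    using assms(2) by blast
qed

definition frobenius_fixed :: "nat \<Rightarrow> 'a::comm_ring_1 set" where
  "frobenius_fixed e = {x. x ^ (CHAR('a) ^ e) = x}"

lemma frobenius_fixed_mono:
  assumes "prime CHAR('a::comm_ring_1)" and "d dvd m"
  shows "frobenius_fixed d \<subseteq> (frobenius_fixed m :: 'a set)"
proof
  fix x :: 'a assume "x \<in> frobenius_fixed d"
  hence "0 dvd x ^ (CHAR('a) ^ m) - x"
    using frobenius_diff_self_dvd[OF assms, of x] by (simp add: frobenius_fixed_def)
  thus "x \<in> frobenius_fixed m"
    by (simp add: frobenius_fixed_def)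
qed

lemma frobenius_fixed_Int:
  assumes "prime CHAR('a::comm_ring_1)"
  shows "frobenius_fixed a \<inter> frobenius_fixed b = (frobenius_fixed (gcd a b) :: 'a set)"
proof
  show "frobenius_fixed a \<inter> frobenius_fixed b \<subseteq> (frobenius_fixed (gcd a b) :: 'a set)"
  proof (induction a b rule: gcd_nat_induct)
    case (step a b)
    have "x \<in> frobenius_fixed (a mod b)" if "x \<in> frobenius_fixed a \<inter> frobenius_fixed b" for x :: 'a
    proof -
      have "x \<in> frobenius_fixed (b * (a div b))"
        using frobenius_fixed_mono[OF assms dvd_triv_left] that by blast
      hence "x ^ (CHAR('a) ^ (a mod b)) = x ^ (CHAR('a) ^ (b * (a div b) + a mod b))"
        by (simp only: frobenius_fixed_def mem_Collect_eq power_add power_mult)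
      thus ?thesis
        using that by (simp add: frobenius_fixed_def)
    qed
    thus ?case
      using step.IH by (auto simp: gcd_red_nat[of a b])
  qed simp
  show "frobenius_fixed (gcd a b) \<subseteq> frobenius_fixed a \<inter> (frobenius_fixed b :: 'a set)"
    using frobenius_fixed_mono[OF assms] by (meson Int_greatest gcd_dvd1 gcd_dvd2)
qed

lemma card_roots_eq_degree_dvd:
  fixes p q :: "'a::idom poly"
  assumes "p dvd q" and "q \<noteq> 0" and "card {x. poly q x = 0} = degree q"
  shows "card {x. poly p x = 0} = degree p"
proof -
  obtain r where q: "q = p * r"
    using assms(1) by (rule dvdE)
  have nonzero: "p \<noteq> 0" "r \<noteq> 0"
    using assms(2) q by auto
  have "degree p + degree r = card ({x. poly p x = 0} \<union> {x. poly r x = 0})"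
    using assms(3) nonzero by (simp add: q degree_mult_eq Collect_disj_eq)
  also have "\<dots> \<le> card {x. poly p x = 0} + card {x. poly r x = 0}"
    by (rule card_Un_le)
  also have "card {x. poly r x = 0} \<le> degree r"
    using nonzero by (intro card_poly_roots_bound)
  finally show ?thesis
    using card_poly_roots_bound[OF nonzero(1)] by linarith
qed

lemma card_frobenius_fixed:
  assumes "CARD('a::{field,finite}) = CHAR('a) ^ m"
  shows "card (frobenius_fixed e :: 'a set) = CHAR('a) ^ gcd m e"
proof -
  define F :: "nat \<Rightarrow> 'a poly" where "F d = [:0, 1:] ^ (CHAR('a) ^ d) - [:0, 1:]" for d
  note prime = prime_CHAR_finite[where 'a = 'a]
  have roots: "{x. poly (F d) x = 0} = frobenius_fixed d" for d
    by (simp add: F_def frobenius_fixed_def)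
  have degree: "degree (F d) = CHAR('a) ^ d" if "d > 0" for d
  proof -
    have "CHAR('a) ^ d > 1"
      using prime that by (intro one_less_power prime_gt_1_nat)
    thus ?thesis
      by (simp add: F_def diff_conv_add_uminus degree_add_eq_left degree_linear_power)
  qed
  have fixed_m: "frobenius_fixed m = (UNIV :: 'a set)"
    using power_CARD_eq_self[where 'a = 'a] by (auto simp: frobenius_fixed_def assms)
  have "m > 0"
    using CARD_gt_one[where 'a = 'a] assms by (cases m) simp_all
  have "card {x. poly (F (gcd m e)) x = 0} = degree (F (gcd m e))"
  proof (rule card_roots_eq_degree_dvd)
    show "F (gcd m e) dvd F m"
      using frobenius_diff_self_dvd[where 'a = "'a poly"] prime by (simp add: F_def)
    show "F m \<noteq> 0"
      using degree[OF \<open>m > 0\<close>] prime by (auto simp: prime_gt_0_nat)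
    show "card {x. poly (F m) x = 0} = degree (F m)"
      using \<open>m > 0\<close> by (simp add: roots fixed_m degree assms)
  qed
  hence "card (frobenius_fixed (gcd m e) :: 'a set) = CHAR('a) ^ gcd m e"
    using \<open>m > 0\<close> by (simp add: roots degree)
  thus ?thesis
    using frobenius_fixed_Int[OF prime, of m e] by (simp add: fixed_m)
qed

section \<open>Lines over a subfield\<close>

locale subfield =
  fixes K :: "'a::field set"
  assumes one_mem: "1 \<in> K"
    and diff_mem: "a \<in> K \<Longrightarrow> b \<in> K \<Longrightarrow> a - b \<in> K"
    and divide_mem: "a \<in> K \<Longrightarrow> b \<in> K \<Longrightarrow> a / b \<in> K"
begin

lemma zero_mem: "0 \<in> K"
  using diff_mem[OF one_mem one_mem] by simp

lemma add_mem: "a \<in> K \<Longrightarrow> b \<in> K \<Longrightarrow> a + b \<in> K"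
  using diff_mem[of a "0 - b"] diff_mem[OF zero_mem] by simp

lemma mult_mem: "a \<in> K \<Longrightarrow> b \<in> K \<Longrightarrow> a * b \<in> K"
  using divide_mem[of a "1 / b"] divide_mem[OF one_mem] by simp

end

lemma subfield_frobenius_fixed:
  assumes "prime CHAR('a::field)"
  shows "subfield (frobenius_fixed e :: 'a set)"
  by unfold_locales (simp_all add: frobenius_fixed_def frobenius_diff[OF assms] power_divide)

definition affine_line :: "'a::field set \<Rightarrow> 'a \<Rightarrow> 'a \<Rightarrow> 'a set" where
  "affine_line K x u = (\<lambda>k. x + u * k) ` K"

lemma card_affine_line:
  assumes "u \<noteq> 0"
  shows "card (affine_line K x u) = card K"
  unfolding affine_line_def using assms by (intro card_image) (simp add: inj_on_def)

context subfield
begin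

lemma affine_line_through:
  "x \<in> affine_line K x u" "y \<in> affine_line K x (y - x)"
  unfolding affine_line_def using zero_mem one_mem by (auto intro: rev_image_eqI)

lemma affine_line_eq_through:
  assumes "y \<in> affine_line K x u" and "z \<in> affine_line K x u" and "y \<noteq> z"
  shows "affine_line K x u = affine_line K y (z - y)"
proof -
  obtain a b where ab: "a \<in> K" "b \<in> K" and y: "y = x + u * a" and z: "z = x + u * b"
    using assms(1,2) by (auto simp: affine_line_def)
  define c where "c = b - a"
  have c: "c \<in> K" "c \<noteq> 0"
    using ab diff_mem assms(3) y z by (auto simp: c_def)
  have direction: "z - y = u * c"
    by (simp add: y z c_def algebra_simps)
  have "x + u * k \<in> affine_line K y (z - y)" if "k \<in> K" for k
  proof -
    have "x + u * k = y + (z - y) * ((k - a) / c)"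
      unfolding direction using c by (simp add: y algebra_simps diff_divide_distrib)
    moreover have "(k - a) / c \<in> K"
      using that ab c by (intro divide_mem diff_mem)
    ultimately show ?thesis
      unfolding affine_line_def by (rule image_eqI)
  qed
  moreover have "y + (z - y) * k \<in> affine_line K x u" if "k \<in> K" for k
  proof -
    have "y + (z - y) * k = x + u * (a + c * k)"
      unfolding direction by (simp add: y algebra_simps)
    moreover have "a + c * k \<in> K"
      using that ab c by (intro add_mem mult_mem)
    ultimately show ?thesis
      unfolding affine_line_def by (rule image_eqI)
  qed
  ultimately show ?thesis
    by (auto simp: affine_line_def)
qed

lemma two_design_affine_lines:
  assumes "finite (UNIV :: 'a set)"
  shows "two_design CARD('a) (card K) 1 UNIV {affine_line K x u | x u. u \<noteq> 0}"
proof -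
  have "card {B \<in> {affine_line K x u | x u. u \<noteq> 0}. P \<subseteq> B} = 1" if "card P = 2" for P
  proof -
    obtain y z where P: "P = {y, z}" "y \<noteq> z"
      using \<open>card P = 2\<close> by (auto simp: card_2_iff)
    have "{B \<in> {affine_line K x u | x u. u \<noteq> 0}. P \<subseteq> B} = {affine_line K y (z - y)}"
    proof (intro equalityI subsetI)
      fix B assume "B \<in> {B \<in> {affine_line K x u | x u. u \<noteq> 0}. P \<subseteq> B}"
      thus "B \<in> {affine_line K y (z - y)}"
        using P affine_line_eq_through[of y _ _ z] by auto
    next
      fix B assume "B \<in> {affine_line K y (z - y)}"
      moreover have "z - y \<noteq> 0"
        using P(2) by simp
      ultimately show "B \<in> {B \<in> {affine_line K x u | x u. u \<noteq> 0}. P \<subseteq> B}"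
        using P(1) affine_line_through by blast
    qed
    thus ?thesis
      by simp
  qed
  thus ?thesis
    using assms by (auto simp: two_design_def card_affine_line)
qed

end

section \<open>Quadruples with vanishing power sums\<close>

lemma add_eq_0_iff_CHAR_2:
  fixes x y :: "'a::ring_1"
  assumes "CHAR('a) = 2"
  shows "x + y = 0 \<longleftrightarrow> x = y"
  by (simp flip: minus_CHAR_2[OF assms])

lemma two_eq_0_CHAR_2:
  assumes "CHAR('a::semiring_1) = 2"
  shows "(2 :: 'a) = 0"
  using of_nat_CHAR[where 'a = 'a] by (simp add: assms)

definition affine_plane :: "'a::plus \<Rightarrow> 'a \<Rightarrow> 'a \<Rightarrow> 'a set" where
  "affine_plane x u v = {x, x + u, x + v, x + u + v}"

definition independent_pair :: "'a::zero \<Rightarrow> 'a \<Rightarrow> bool" where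
  "independent_pair u v \<longleftrightarrow> u \<noteq> 0 \<and> v \<noteq> 0 \<and> u \<noteq> v"

lemma sum_affine_plane:
  fixes g :: "'a::ring_1 \<Rightarrow> 'b::comm_monoid_add"
  assumes "CHAR('a) = 2" and "independent_pair u v"
  shows "sum g (affine_plane x u v) = g x + g (x + u) + g (x + v) + g (x + u + v)"
  using assms(2)
  by (simp add: affine_plane_def independent_pair_def add.assoc add_eq_0_iff_CHAR_2[OF assms(1)])

lemma card_affine_plane:
  fixes u v :: "'a::ring_1"
  assumes "CHAR('a) = 2" and "independent_pair u v"
  shows "card (affine_plane x u v) = 4"
  using sum_affine_plane[OF assms, of "\<lambda>_. 1 :: nat"] by simp

lemma card_4_sum_0_iff_affine_plane:
  fixes T :: "'a::ring_1 set"
  assumes "CHAR('a) = 2"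
  shows "card T = 4 \<and> \<Sum>T = 0 \<longleftrightarrow> (\<exists>x u v. independent_pair u v \<and> T = affine_plane x u v)"
proof
  assume T: "card T = 4 \<and> \<Sum>T = 0"
  then obtain x y z w where T_eq: "T = {x, y, z, w}" and distinct: "distinct [x, y, z, w]"
    by (auto simp: card_Suc_eq numeral_eq_Suc)
  define u v where "u = y - x" and "v = z - x"
  have "x + y + z + w = 0"
    using T distinct by (simp add: T_eq add.assoc)
  hence "w = x + y + z"
    by (simp add: add_eq_0_iff_CHAR_2[OF assms])
  also have "\<dots> = y + z - x"
    by (simp add: minus_CHAR_2[OF assms] add_ac)
  also have "\<dots> = x + u + v"
    by (simp add: u_def v_def)
  finally have "T = affine_plane x u v"
    by (simp add: T_eq affine_plane_def u_def v_def)
  moreover have "independent_pair u v"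
    using distinct by (auto simp: independent_pair_def u_def v_def)
  ultimately show "\<exists>x u v. independent_pair u v \<and> T = affine_plane x u v"
    by blast
next
  assume "\<exists>x u v. independent_pair u v \<and> T = affine_plane x u v"
  then obtain x u v where "independent_pair u v" "T = affine_plane x u v"
    by blast
  moreover have "x + (x + u) + (x + v) + (x + u + v) = 2 * (2 * x + u + v)"
    by (simp only: mult_2 algebra_simps)
  ultimately show "card T = 4 \<and> \<Sum>T = 0"
    using assms by (simp add: card_affine_plane sum_affine_plane two_eq_0_CHAR_2)
qed

lemma sum_power_affine_plane:
  fixes x u v :: "'a::comm_ring_1"
  assumes "CHAR('a) = 2" and "independent_pair u v"
  shows "(\<Sum>t\<in>affine_plane x u v. t ^ (1 + 2 ^ e)) = u * v ^ (2 ^ e) + u ^ (2 ^ e) * v"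
proof -
  have frobenius: "(y + z) ^ (2 ^ e) = y ^ (2 ^ e) + z ^ (2 ^ e)" for y z :: 'a
    using freshmans_dream'[where 'a = 'a] by (simp add: assms(1))
  have "(\<Sum>t\<in>affine_plane x u v. t ^ (1 + 2 ^ e))
      = 2 * (2 * x * x ^ 2 ^ e + x * u ^ 2 ^ e + x * v ^ 2 ^ e + u * x ^ 2 ^ e + v * x ^ 2 ^ e
             + u * u ^ 2 ^ e + v * v ^ 2 ^ e) + (u * v ^ 2 ^ e + u ^ 2 ^ e * v)"
    unfolding sum_affine_plane[OF assms] power_add power_one_right frobenius
    by (simp add: algebra_simps)
  thus ?thesis
    by (simp add: two_eq_0_CHAR_2[OF assms(1)])
qed

lemma sum_power_affine_plane_eq_0_iff:
  fixes x u v :: "'a::field"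
  assumes "CHAR('a) = 2" and "independent_pair u v"
  shows "(\<Sum>t\<in>affine_plane x u v. t ^ (1 + 2 ^ e)) = 0 \<longleftrightarrow> v / u \<in> frobenius_fixed e"
  unfolding sum_power_affine_plane[OF assms] add_eq_0_iff_CHAR_2[OF assms(1)]
  using assms(2)
  by (simp add: frobenius_fixed_def independent_pair_def assms(1) power_divide frac_eq_eq mult_ac)

lemma (in subfield) affine_plane_eq_affine_line:
  assumes "CHAR('a) = 2" and "card K = 4" and "independent_pair u v" and "v / u \<in> K"
  shows "affine_plane x u v = affine_line K x u"
proof (rule card_subset_eq)
  have "u \<noteq> 0"
    using assms(3) by (simp add: independent_pair_def)
  thus "card (affine_plane x u v) = card (affine_line K x u)"
    using assms by (simp add: card_affine_plane card_affine_line)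
  show "finite (affine_line K x u)"
    unfolding affine_line_def using assms(2) by (intro finite_imageI card_ge_0_finite) simp
  have "{x + u * 0, x + u * 1, x + u * (v / u), x + u * (1 + v / u)} \<subseteq> affine_line K x u"
    unfolding affine_line_def using assms(4) zero_mem one_mem add_mem by blast
  thus "affine_plane x u v \<subseteq> affine_line K x u"
    using \<open>u \<noteq> 0\<close> by (simp add: affine_plane_def algebra_simps)
qed

lemma vanishing_power_sums_iff_affine_line:
  fixes T :: "'a::field set"
  assumes "CHAR('a) = 2" and "card (frobenius_fixed e :: 'a set) = 4"
  shows "card T = 4 \<and> \<Sum>T = 0 \<and> (\<Sum>t\<in>T. t ^ (1 + 2 ^ e)) = 0 \<longleftrightarrow>
    (\<exists>x u. u \<noteq> 0 \<and> T = affine_line (frobenius_fixed e) x u)"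
    (is "?vanishing \<longleftrightarrow> ?line")
proof -
  interpret subfield "frobenius_fixed e :: 'a set"
    using assms(1) by (intro subfield_frobenius_fixed) simp
  have "?vanishing \<longleftrightarrow>
      (\<exists>x u v. independent_pair u v \<and> v / u \<in> frobenius_fixed e \<and> T = affine_plane x u v)"
    using card_4_sum_0_iff_affine_plane[OF assms(1), of T]
      sum_power_affine_plane_eq_0_iff[OF assms(1), where e = e]
    by blast
  also have "\<dots> \<longleftrightarrow> (\<exists>x u v. independent_pair u v \<and> v / u \<in> frobenius_fixed e \<and>
      T = affine_line (frobenius_fixed e) x u)"
    using affine_plane_eq_affine_line[OF assms] by metis
  also have "\<dots> \<longleftrightarrow> ?line"
  proof -
    have "\<not> frobenius_fixed e \<subseteq> {0, 1 :: 'a}"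
      using card_mono[of "{0, 1 :: 'a}" "frobenius_fixed e"] assms(2) by auto
    then obtain w :: 'a where w: "w \<in> frobenius_fixed e" "w \<noteq> 0" "w \<noteq> 1"
      by auto
    have "\<exists>v. independent_pair u v \<and> v / u \<in> frobenius_fixed e" if "u \<noteq> 0" for u :: 'a
      using w that by (intro exI[of _ "w * u"]) (auto simp: independent_pair_def)
    thus ?thesis
      unfolding independent_pair_def by metis
  qed
  finally show ?thesis .
qed

theorem two_design_vanishing_power_sums:
  assumes "CARD('a::{field,finite}) = 2 ^ m" and "gcd m e = 2"
  shows "two_design (2 ^ m) 4 1 (UNIV :: 'a set)
    {T. card T = 4 \<and> \<Sum>T = 0 \<and> (\<Sum>t\<in>T. t ^ (1 + 2 ^ e)) = 0}"
proof -
  have char: "CHAR('a) = 2"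
    using two_is_prime_nat assms(1) by (rule CHAR_eq_if_CARD_eq_prime_power)
  hence card: "card (frobenius_fixed e :: 'a set) = 4"
    using card_frobenius_fixed[where 'a = 'a, of m e] assms by simp
  interpret subfield "frobenius_fixed e :: 'a set"
    using char by (intro subfield_frobenius_fixed) simp
  show ?thesis
    using two_design_affine_lines unfolding vanishing_power_sums_iff_affine_line[OF char card]
    by (simp add: card assms(1) conj_commute)
qed

section \<open>Evaluation of binary polynomials in an extension field\<close>

lemma of_bit_add_CHAR_2:
  assumes "CHAR('a::ring_1) = 2"
  shows "(of_bit (a + b) :: 'a) = of_bit a + of_bit b"
  by (cases a; cases b) (simp_all add: two_eq_0_CHAR_2[OF assms])

definition ext_eval :: "bit poly \<Rightarrow> 'a::comm_ring_1 \<Rightarrow> 'a" where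
  "ext_eval p x = poly (map_poly of_bit p) x"

lemma ext_eval_0 [simp]: "ext_eval 0 x = 0"
  by (simp add: ext_eval_def)

lemma ext_eval_pCons [simp]: "ext_eval (pCons a p) x = of_bit a + x * ext_eval p x"
  by (simp add: ext_eval_def map_poly_pCons)

lemma ext_eval_add:
  assumes "CHAR('a::comm_ring_1) = 2"
  shows "ext_eval (p + q) (x :: 'a) = ext_eval p x + ext_eval q x"
  by (induction p q rule: poly_induct2)
     (simp_all add: of_bit_add_CHAR_2[OF assms] two_eq_0_CHAR_2[OF assms] algebra_simps)

lemma ext_eval_mult:
  assumes "CHAR('a::comm_ring_1) = 2"
  shows "ext_eval (p * q) (x :: 'a) = ext_eval p x * ext_eval q x"
proof (induction p)
  case (pCons a p)
  have "ext_eval (smult a q) x = of_bit a * ext_eval q x"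
    by (cases a) simp_all
  thus ?case
    using pCons.IH by (simp add: ext_eval_add[OF assms] algebra_simps)
qed simp

lemma ext_eval_monom: "ext_eval (monom 1 n) x = x ^ n"
  by (induction n) (simp_all add: monom_Suc monom_0)

lemma ext_eval_monom_minus_one:
  assumes "CHAR('a::comm_ring_1) = 2"
  shows "ext_eval (monom 1 n - 1) (x :: 'a) = x ^ n - 1"
proof -
  have "ext_eval (monom 1 n + 1) x = x ^ n + 1"
    by (simp add: ext_eval_add[OF assms] ext_eval_monom one_pCons)
  moreover have "monom 1 n - 1 = monom (1 :: bit) n + 1"
    by (simp add: poly_eq_iff)
  ultimately show ?thesis
    using minus_CHAR_2[OF assms, of "x ^ n" 1] by (simp only:)
qed

section \<open>Cyclic codes and their zeros\<close>

lemma is_min_poly_dvd_iff: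
  fixes \<beta> :: "'a::field"
  assumes char: "CHAR('a) = 2" and p: "is_min_poly \<beta> p"
  shows "p dvd q \<longleftrightarrow> ext_eval q \<beta> = 0"
proof
  have root: "ext_eval p \<beta> = 0" and "p \<noteq> 0"
    using p by (auto simp: is_min_poly_def ext_eval_def)
  show "ext_eval q \<beta> = 0" if "p dvd q"
    using that root by (auto simp: ext_eval_mult[OF char])
  assume "ext_eval q \<beta> = 0"
  hence "ext_eval (q div p * p + q mod p) \<beta> = 0"
    by (simp only: div_mult_mod_eq)
  hence "ext_eval (q mod p) \<beta> = 0"
    by (simp only: ext_eval_add[OF char] ext_eval_mult[OF char] root) simp
  hence "degree p \<le> degree (q mod p)" if "q mod p \<noteq> 0"
    using p that unfolding is_min_poly_def ext_eval_def by blast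
  moreover have "degree (q mod p) < degree p" if "q mod p \<noteq> 0"
    using \<open>p \<noteq> 0\<close> that by (rule degree_mod_less')
  ultimately have "q mod p = 0"
    using leD by blast
  thus "p dvd q"
    by (simp only: dvd_eq_mod_eq_0)
qed

lemma is_min_poly_exists:
  assumes "p \<noteq> 0" and "ext_eval p \<beta> = 0"
  shows "\<exists>r. is_min_poly \<beta> r"
proof -
  define r where "r = arg_min degree (\<lambda>q. q \<noteq> 0 \<and> ext_eval q \<beta> = 0)"
  have "r \<noteq> 0 \<and> ext_eval r \<beta> = 0" "\<And>q. q \<noteq> 0 \<and> ext_eval q \<beta> = 0 \<Longrightarrow> degree r \<le> degree q"
    using arg_min_nat_lemma[of "\<lambda>q. q \<noteq> 0 \<and> ext_eval q \<beta> = 0" p degree] assms by (auto simp: r_def)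
  moreover from this have "lead_coeff r = 1"
    by (metis bit_not_one_iff leading_coeff_0_iff)
  ultimately have "is_min_poly \<beta> r"
    by (simp add: is_min_poly_def ext_eval_def)
  thus ?thesis ..
qed

lemma is_min_poly_unique:
  fixes \<beta> :: "'a::field"
  assumes char: "CHAR('a) = 2" and "is_min_poly \<beta> p" "is_min_poly \<beta> q"
  shows "p = q"
proof -
  have "p dvd q" "q dvd p"
    using assms is_min_poly_dvd_iff[OF char] by (auto simp: is_min_poly_def ext_eval_def)
  moreover have "normalize p = p" "normalize q = q"
    using assms by (simp_all add: is_min_poly_def unit_factor_1_imp_normalized unit_factor_poly_def)
  ultimately show ?thesis
    by (rule associated_eqI)
qed

lemma min_poly_dvd_iff:
  fixes \<beta> :: "'a::field"
  assumes char: "CHAR('a) = 2" and p: "p \<noteq> 0" "ext_eval p \<beta> = 0"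
  shows "min_poly \<beta> dvd q \<longleftrightarrow> ext_eval q \<beta> = 0"
proof -
  have "\<exists>!r. is_min_poly \<beta> r"
    using is_min_poly_exists[OF p] is_min_poly_unique[OF char] by blast
  hence "is_min_poly \<beta> (min_poly \<beta>)"
    unfolding min_poly_def by (rule theI')
  thus ?thesis
    by (rule is_min_poly_dvd_iff[OF char])
qed

lemma mem_cyclic_code_iff_dvd:
  assumes "g dvd monom 1 n - 1"
  shows "c \<in> cyclic_code n g \<longleftrightarrow> length c = n \<and> g dvd Poly c"
proof -
  have "(\<exists>a. [Poly c = a * g] (mod (monom 1 n - 1))) \<longleftrightarrow> g dvd Poly c"
  proof
    assume "\<exists>a. [Poly c = a * g] (mod (monom 1 n - 1))"
    then obtain a where "[Poly c = a * g] (mod g)"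
      using assms cong_dvd_modulus by blast
    thus "g dvd Poly c"
      using cong_dvd_iff dvd_triv_right by blast
  next
    assume "g dvd Poly c"
    thus "\<exists>a. [Poly c = a * g] (mod (monom 1 n - 1))"
      by (metis cong_refl dvdE mult.commute)
  qed
  thus ?thesis
    by (simp add: cyclic_code_def)
qed

definition code_with_zeros :: "nat \<Rightarrow> 'a::comm_ring_1 set \<Rightarrow> bit list set" where
  "code_with_zeros n Z = {c. length c = n \<and> (\<forall>\<beta>\<in>Z. ext_eval (Poly c) \<beta> = 0)}"

lemma cyclic_code_lcm_min_poly:
  fixes \<beta> \<gamma> :: "'a::field"
  assumes char: "CHAR('a) = 2" and "n > 0" and "\<beta> ^ n = 1" and "\<gamma> ^ n = 1"
  shows "cyclic_code n (lcm (min_poly \<beta>) (min_poly \<gamma>)) = code_with_zeros n {\<beta>, \<gamma>}"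
proof -
  have "coeff (monom 1 n - 1 :: bit poly) n = 1"
    using \<open>n > 0\<close> by simp
  hence nonzero: "monom 1 n - 1 \<noteq> (0 :: bit poly)"
    by (metis coeff_0 zero_neq_one)
  have roots: "ext_eval (monom 1 n - 1) \<beta> = 0" "ext_eval (monom 1 n - 1) \<gamma> = 0"
    using assms by (simp_all add: ext_eval_monom_minus_one)
  note dvd_iff = min_poly_dvd_iff[OF char nonzero roots(1)]
    min_poly_dvd_iff[OF char nonzero roots(2)]
  have "c \<in> cyclic_code n (lcm (min_poly \<beta>) (min_poly \<gamma>)) \<longleftrightarrow> c \<in> code_with_zeros n {\<beta>, \<gamma>}" for c
    by (subst mem_cyclic_code_iff_dvd) (simp_all add: dvd_iff roots code_with_zeros_def)
  thus ?thesis
    by blast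
qed

section \<open>Supports of the words of an extended code\<close>

lemma support_Nil [simp]: "support [] = {}"
  by (simp add: support_def)

lemma support_Cons: "support (a # c) = (if a = 0 then {} else {0}) \<union> Suc ` support c"
  by (auto simp: support_def less_Suc_eq_0_disj)

lemma finite_support [simp]: "finite (support c)"
  by (simp add: support_def)

lemma sum_list_eq_odd_card_support: "sum_list c = of_bool (odd (card (support c)))"
  by (induction c) (simp_all add: support_Cons card_image)

lemma ext_eval_Poly: "ext_eval (Poly c) x = (\<Sum>i\<in>support c. x ^ i)"
  by (induction c) (simp_all add: support_Cons sum.reindex sum_distrib_left)

lemma length_support_exists:
  assumes "S \<subseteq> {..<n}"
  obtains c where "length c = n" and "support c = S"
proof
  let ?c = "map (\<lambda>i. of_bool (i \<in> S)) [0..<n]"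
  show "length ?c = n" "support ?c = S"
    using assms by (auto simp: support_def)
qed

lemma support_append_sum_list_iff:
  "S = support (c @ [sum_list c]) \<longleftrightarrow>
     S \<subseteq> {..length c} \<and> even (card S) \<and> S \<inter> {..<length c} = support c"
proof -
  let ?n = "length c"
  have support_less: "support c \<subseteq> {..<?n}"
    by (auto simp: support_def)
  hence parity_coord: "?n \<notin> support c"
    by blast
  have support_eq: "support (c @ [sum_list c])
      = support c \<union> (if even (card (support c)) then {} else {?n})"
    unfolding sum_list_eq_odd_card_support by (auto simp: support_def nth_append less_Suc_eq)
  show ?thesis
  proof
    assume S: "S = support (c @ [sum_list c])"
    show "S \<subseteq> {..?n} \<and> even (card S) \<and> S \<inter> {..<?n} = support c"
      using support_less parity_coord by (auto simp: S support_eq)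
  next
    assume S: "S \<subseteq> {..?n} \<and> even (card S) \<and> S \<inter> {..<?n} = support c"
    moreover have "{..?n} = {..<?n} \<union> {?n}"
      by auto
    ultimately have S_eq: "S = support c \<union> S \<inter> {?n}"
      by blast
    have "card S = card (support c) + card (S \<inter> {?n})"
      using parity_coord by (subst S_eq, subst card_Un_disjoint) auto
    hence "?n \<in> S \<longleftrightarrow> odd (card (support c))"
      using S by (cases "?n \<in> S") simp_all
    thus "S = support (c @ [sum_list c])"
      using S_eq unfolding support_eq by (cases "?n \<in> S") simp_all
  qed
qed

text \<open>
  The coordinates of the extended code are labelled by the field elements: $i < n$ stands for
  $\alpha^i$ and the parity coordinate $n$ for $0$, which does not contribute to power sums.
\<close>

definition coord_point :: "nat \<Rightarrow> 'a::field \<Rightarrow> nat \<Rightarrow> 'a" where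
  "coord_point n \<alpha> i = (if i < n then \<alpha> ^ i else 0)"

lemma sum_coord_point_power:
  assumes "S \<subseteq> {..n}" and "j > 0"
  shows "(\<Sum>i\<in>S. coord_point n \<alpha> i ^ j) = (\<Sum>i\<in>S \<inter> {..<n}. (\<alpha> ^ j) ^ i)"
proof -
  have "finite S"
    using assms(1) finite_subset by blast
  hence "(\<Sum>i\<in>S. coord_point n \<alpha> i ^ j) = (\<Sum>i\<in>S \<inter> {..<n}. coord_point n \<alpha> i ^ j)"
    using assms by (intro sum.mono_neutral_right) (auto simp: coord_point_def power_0_left)
  also have "\<dots> = (\<Sum>i\<in>S \<inter> {..<n}. (\<alpha> ^ j) ^ i)"
    by (rule sum.cong) (auto simp: coord_point_def mult.commute simp flip: power_mult)
  finally show ?thesis .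
qed

lemma support_image_extended_code:
  assumes "\<forall>j\<in>J. j > 0"
  shows "support ` extended_code (code_with_zeros n ((\<lambda>j. \<alpha> ^ j) ` J))
       = {S. S \<subseteq> {..n} \<and> even (card S) \<and> (\<forall>j\<in>J. (\<Sum>i\<in>S. coord_point n \<alpha> i ^ j) = 0)}"
    (is "?supports = ?vanishing")
proof (intro equalityI subsetI)
  fix S assume "S \<in> ?supports"
  then obtain c where c: "length c = n" "\<forall>j\<in>J. (\<Sum>i\<in>support c. (\<alpha> ^ j) ^ i) = 0"
    and "S = support (c @ [sum_list c])"
    by (auto simp: extended_code_def code_with_zeros_def ext_eval_Poly)
  hence "S \<subseteq> {..n}" "even (card S)" "S \<inter> {..<n} = support c"
    using support_append_sum_list_iff[of S c] by auto
  thus "S \<in> ?vanishing"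
    using c(2) assms by (simp add: sum_coord_point_power)
next
  fix S assume S: "S \<in> ?vanishing"
  obtain c where c: "length c = n" "support c = S \<inter> {..<n}"
    using length_support_exists[of "S \<inter> {..<n}"] by blast
  have "S = support (c @ [sum_list c])"
    using S c support_append_sum_list_iff[of S c] by auto
  moreover have "c \<in> code_with_zeros n ((\<lambda>j. \<alpha> ^ j) ` J)"
    using S c assms sum_coord_point_power[of S n _ \<alpha>]
    by (auto simp: code_with_zeros_def ext_eval_Poly)
  ultimately show "S \<in> ?supports"
    by (auto simp: extended_code_def)
qed

lemma supports_of_weight:
  assumes inj: "inj_on (coord_point n \<alpha>) {..n}" and positive: "\<forall>j\<in>J. j > 0" and "even w"
  shows "{support c | c. c \<in> extended_code (code_with_zeros n ((\<lambda>j. \<alpha> ^ j) ` J)) \<and>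
      hamming_weight c = w}
    = {S. S \<subseteq> {..n} \<and>
        coord_point n \<alpha> ` S \<in> {T. card T = w \<and> (\<forall>j\<in>J. (\<Sum>t\<in>T. t ^ j) = 0)}}"
    (is "?supports = _")
proof -
  have injS: "inj_on (coord_point n \<alpha>) S" if "S \<subseteq> {..n}" for S
    using inj that by (rule inj_on_subset)
  have "?supports
      = {S \<in> support ` extended_code (code_with_zeros n ((\<lambda>j. \<alpha> ^ j) ` J)). card S = w}"
    by (auto simp: hamming_weight_def)
  also have "\<dots> = {S. S \<subseteq> {..n} \<and> card S = w \<and>
      (\<forall>j\<in>J. (\<Sum>i\<in>S. coord_point n \<alpha> i ^ j) = 0)}"
    using \<open>even w\<close> by (auto simp: support_image_extended_code[OF positive])
  finally show ?thesis
    using injS by (auto simp: card_image sum.reindex)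
qed

section \<open>Coordinates as field elements\<close>

lemma power_int_eq_power_mod:
  fixes x :: "'a::field"
  assumes "x ^ n = 1" and "n > 0"
  shows "x powi k = x ^ nat (k mod int n)"
proof -
  have "x \<noteq> 0"
    using assms by (auto simp: power_0_left)
  have "x powi k = x powi (int n * (k div int n) + k mod int n)"
    by simp
  also have "\<dots> = (x powi int n) powi (k div int n) * x powi (k mod int n)"
    using \<open>x \<noteq> 0\<close> by (subst power_int_add) (simp_all only: power_int_mult simp_thms)
  also have "x powi int n = 1"
    using assms(1) by simp
  also have "x powi (k mod int n) = x ^ nat (k mod int n)"
    using assms(2) by (simp add: power_int_def)
  finally show ?thesis
    by simp
qed

lemma generates_units_nonzero:
  assumes "generates_units \<alpha>"
  shows "\<alpha> \<noteq> 0"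
proof -
  have "\<alpha> powi 1 \<in> UNIV - {0}"
    using assms unfolding generates_units_def by blast
  thus ?thesis
    by simp
qed

lemma generates_units_bij_betw:
  fixes \<alpha> :: "'a::{field,finite}"
  assumes "generates_units \<alpha>"
  shows "bij_betw (\<lambda>i. \<alpha> ^ i) {..<CARD('a) - 1} (UNIV - {0})"
proof -
  let ?n = "CARD('a) - 1"
  have card: "card (UNIV - {0 :: 'a}) = ?n"
    by simp
  have "?n > 0"
    using CARD_gt_one[where 'a = 'a] by simp
  have "x \<in> (\<lambda>i. \<alpha> ^ i) ` {..<?n}" if "x \<noteq> 0" for x
  proof -
    obtain k :: int where "x = \<alpha> powi k"
      using assms \<open>x \<noteq> 0\<close> unfolding generates_units_def by blast
    also have "\<dots> = \<alpha> ^ nat (k mod int ?n)"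
      using power_CARD_minus_one_eq_one[OF generates_units_nonzero[OF assms]] \<open>?n > 0\<close>
      by (rule power_int_eq_power_mod)
    finally show ?thesis
      using \<open>?n > 0\<close> by (simp add: nat_less_iff)
  qed
  hence image: "(\<lambda>i. \<alpha> ^ i) ` {..<?n} = UNIV - {0}"
    using generates_units_nonzero[OF assms] by auto
  moreover have "inj_on (\<lambda>i. \<alpha> ^ i) {..<?n}"
    by (rule eq_card_imp_inj_on) (simp_all only: image card card_lessThan finite_lessThan)
  ultimately show ?thesis
    by (simp add: bij_betw_def)
qed

lemma coord_point_bij_betw:
  fixes \<alpha> :: "'a::{field,finite}"
  assumes "generates_units \<alpha>" and "n = CARD('a) - 1"
  shows "bij_betw (coord_point n \<alpha>) {..n} UNIV"
proof -
  have "bij_betw (coord_point n \<alpha>) {..<n} (UNIV - {0})"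
    using generates_units_bij_betw[OF assms(1)]
    by (subst bij_betw_cong[where g = "\<lambda>i. \<alpha> ^ i"]) (auto simp: coord_point_def assms(2))
  hence "bij_betw (coord_point n \<alpha>) ({..<n} \<union> {n}) ((UNIV - {0}) \<union> {0})"
    by (rule bij_betw_combine) (auto simp: coord_point_def bij_betw_def)
  moreover have "{..<n} \<union> {n} = {..n}" "(UNIV - {0}) \<union> {0} = (UNIV :: 'a set)"
    by auto
  ultimately show ?thesis
    by simp
qed

section \<open>Transport of designs along bijections\<close>

lemma bij_betw_image_blocks:
  assumes bij: "bij_betw f V W" and blocks: "\<And>B. B \<in> \<B> \<Longrightarrow> B \<subseteq> W" and P: "P \<subseteq> V"
  shows "bij_betw (image f) {B. B \<subseteq> V \<and> f ` B \<in> \<B> \<and> P \<subseteq> B} {B \<in> \<B>. f ` P \<subseteq> B}"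
proof (rule bij_betw_subset[OF bij_betw_image_Pow[OF bij]])
  show "image f ` {B. B \<subseteq> V \<and> f ` B \<in> \<B> \<and> P \<subseteq> B} = {B \<in> \<B>. f ` P \<subseteq> B}"
  proof (intro equalityI subsetI)
    fix B assume B: "B \<in> {B \<in> \<B>. f ` P \<subseteq> B}"
    hence "B \<subseteq> f ` V"
      using blocks bij by (simp add: bij_betw_def)
    then obtain A where A: "A \<subseteq> V" "B = f ` A"
      by (auto simp: subset_image_iff)
    hence "P \<subseteq> A"
      using B P inj_on_image_mem_iff[OF bij_betw_imp_inj_on[OF bij]] by blast
    thus "B \<in> image f ` {B. B \<subseteq> V \<and> f ` B \<in> \<B> \<and> P \<subseteq> B}"
      using A B by blast
  qed auto
qed auto

lemma two_design_bij_betw: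
  assumes bij: "bij_betw f V W" and design: "two_design v k l W \<B>"
  shows "two_design v k l V {B. B \<subseteq> V \<and> f ` B \<in> \<B>}"
proof -
  have card_image: "card (f ` A) = card A" if "A \<subseteq> V" for A
    using bij_betw_imp_inj_on[OF bij] that by (meson card_image inj_on_subset)
  have "card {B \<in> {B. B \<subseteq> V \<and> f ` B \<in> \<B>}. P \<subseteq> B} = l" if P: "P \<subseteq> V" "card P = 2" for P
  proof -
    have "card {B. B \<subseteq> V \<and> f ` B \<in> \<B> \<and> P \<subseteq> B} = card {B \<in> \<B>. f ` P \<subseteq> B}"
      using design by (intro bij_betw_same_card[OF bij_betw_image_blocks[OF bij _ P(1)]])
        (simp add: two_design_def)
    moreover have "f ` P \<subseteq> W" "card (f ` P) = 2"
      using bij P card_image[OF P(1)] by (auto simp: bij_betw_def)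
    ultimately show ?thesis
      using design by (simp add: two_design_def conj_assoc)
  qed
  thus ?thesis
    using design bij card_image unfolding two_design_def
    by (auto simp: bij_betw_finite bij_betw_same_card)
qed

theorem theorem3p8:
  fixes m e :: nat and \<alpha> :: "'a::{field,finite}"
  assumes "m \<ge> 4" and "even m"
    and "2 \<le> e" and "e \<le> m div 2" and "gcd m e = 2"
    and "CARD('a) = 2 ^ m"
    and "generates_units \<alpha>"
  shows "two_design (2 ^ m) 4 1 {0..<2 ^ m}
           {support c | c.
              c \<in> extended_code (cyclic_code (2 ^ m - 1)
                     (lcm (min_poly \<alpha>) (min_poly (\<alpha> ^ (1 + 2 ^ e))))) \<and>
              hamming_weight c = 4}"
proof -
  define n :: nat where "n = 2 ^ m - 1"
  define J :: "nat set" where "J = {1, 1 + 2 ^ e}"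
  have char: "CHAR('a) = 2"
    using two_is_prime_nat assms(6) by (rule CHAR_eq_if_CARD_eq_prime_power)
  have "n > 0" and "2 ^ m = Suc n"
    using CARD_gt_one[where 'a = 'a] by (simp_all add: assms(6) n_def)
  have bij: "bij_betw (coord_point n \<alpha>) {..n} UNIV"
    using assms(6,7) by (intro coord_point_bij_betw) (simp_all add: n_def)
  have "(\<alpha> ^ j) ^ n = 1" for j
    using power_CARD_minus_one_eq_one[of "\<alpha> ^ j"] generates_units_nonzero[OF assms(7)]
    by (simp add: assms(6) n_def)
  from cyclic_code_lcm_min_poly[OF char \<open>n > 0\<close> this this, of 1]
  have "cyclic_code n (lcm (min_poly \<alpha>) (min_poly (\<alpha> ^ (1 + 2 ^ e))))
      = code_with_zeros n ((\<lambda>j. \<alpha> ^ j) ` J)"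
    by (simp only: J_def image_insert image_empty power_one_right)
  moreover have "two_design (2 ^ m) 4 1 {..n} {S. S \<subseteq> {..n} \<and>
      coord_point n \<alpha> ` S \<in> {T. card T = 4 \<and> (\<forall>j\<in>J. (\<Sum>t\<in>T. t ^ j) = 0)}}"
    using two_design_bij_betw[OF bij two_design_vanishing_power_sums[OF assms(6,5)]]
    by (simp add: J_def)
  moreover have "{0..<2 ^ m} = {..n}"
    by (simp only: \<open>2 ^ m = Suc n\<close> atLeast0LessThan lessThan_Suc_atMost)
  ultimately show ?thesis
    using supports_of_weight[OF bij_betw_imp_inj_on[OF bij], of J 4] by (simp add: n_def J_def)
qed

end
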